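(* Let $G$ be a graph. Then \[p_2(G) \leq \max\left\{\frac{v_{\mathrm{odd}}(G)}{2}, 2\left\lceil \frac{\Delta(G)}{2}\right \rceil\right\}.\]
   Context: All graphs are finite and simple. A path odd-cover of a graph $G=(V,E)$ is a collection of paths in the complete graph on $V$ (i.e. paths whose vertex sets are contained in $V$) whose edge sets have symmetric difference equal to $E$; $p_2(G)$ is the minimum cardinality of a path odd-cover of $G$. $\Delta(G)$ is the maximum degree of $G$ and $v_{\mathrm{odd}}(G)$ is the number of vertices of odd degree in $G$. *)

theory Defs
  imports Complex_Main
begin

record 'a ugraph =
  vertices :: "'a set"
  edges :: "'a set set"

definition simple_graph :: "'a ugraph \<Rightarrow> bool" where
  "simple_graph G \<longleftrightarrow>
     finite (vertices G) \<and> (\<forall>e\<in>edges G. e \<subseteq> vertices G \<and> card e = 2)"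

definition vertex_degree :: "'a ugraph \<Rightarrow> 'a \<Rightarrow> nat" where
  "vertex_degree G v = card {e \<in> edges G. v \<in> e}"

text \<open>The inserted \<open>0\<close> only matters for the graph without vertices, whose maximum degree is \<open>0\<close>.\<close>

definition max_degree :: "'a ugraph \<Rightarrow> nat" where
  "max_degree G = Max (insert 0 (vertex_degree G ` vertices G))"

definition v_odd :: "'a ugraph \<Rightarrow> nat" where
  "v_odd G = card {v \<in> vertices G. odd (vertex_degree G v)}"

text \<open>
  A path is itself a graph, so a vertex sequence and its reversal give the same path.
  A single vertex counts as a path (of length \<open>0\<close>).
\<close>

definition path_of :: "'a list \<Rightarrow> 'a ugraph" where
  "path_of vs = \<lparr>vertices = set vs, edges = {{vs ! i, vs ! Suc i} | i. Suc i < length vs}\<rparr>"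

definition is_path :: "'a ugraph \<Rightarrow> bool" where
  "is_path P \<longleftrightarrow> (\<exists>vs. vs \<noteq> [] \<and> distinct vs \<and> P = path_of vs)"

text \<open>
  The symmetric difference of a finite family of sets consists of the elements that lie in an
  odd number of members; \<open>edge_sym_diff_insert\<close> below is the recursive description.
\<close>

definition edge_sym_diff :: "'a ugraph set \<Rightarrow> 'a set set" where
  "edge_sym_diff C = {e. odd (card {P \<in> C. e \<in> edges P})}"

text \<open>
  The paths need not be subgraphs of \<open>G\<close>: only their vertices have to belong to \<open>G\<close>.
\<close>

definition path_odd_cover :: "'a ugraph \<Rightarrow> 'a ugraph set \<Rightarrow> bool" where
  "path_odd_cover G C \<longleftrightarrow>
     finite C \<and> (\<forall>P\<in>C. is_path P \<and> vertices P \<subseteq> vertices G) \<and> edge_sym_diff C = edges G"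

text \<open>The minimum is attained for every simple graph, see \<open>path_odd_cover_exists\<close> below.\<close>

definition p2 :: "'a ugraph \<Rightarrow> nat" where
  "p2 G = (LEAST k. \<exists>C. path_odd_cover G C \<and> card C = k)"

lemma edge_sym_diff_empty: "edge_sym_diff {} = {}"
  by (simp add: edge_sym_diff_def)

lemma edge_sym_diff_insert:
  assumes "finite C" "P \<notin> C"
  shows "edge_sym_diff (insert P C) =
    sym_diff (edges P) (edge_sym_diff C)"
proof -
  have "{Q \<in> insert P C. e \<in> edges Q} =
      (if e \<in> edges P then insert P {Q \<in> C. e \<in> edges Q} else {Q \<in> C. e \<in> edges Q})" for e
    by auto
  then show ?thesis
    using assms by (auto simp: edge_sym_diff_def)
qed

lemma path_of_pair: "path_of [a, b] = \<lparr>vertices = {a, b}, edges = {{a, b}}\<rparr>"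
proof -
  have "Suc i < length [a, b] \<longleftrightarrow> i = 0" for i
    by simp
  then show ?thesis
    unfolding path_of_def by simp
qed

lemma path_odd_cover_exists:
  assumes "simple_graph G"
  shows "\<exists>C. path_odd_cover G C"
proof -
  define f :: "'a set \<Rightarrow> 'a ugraph" where "f e = \<lparr>vertices = e, edges = {e}\<rparr>" for e
  have "edges G \<subseteq> Pow (vertices G)"
    using assms by (auto simp: simple_graph_def)
  then have fin: "finite (edges G)"
    using assms finite_subset[of "edges G" "Pow (vertices G)"] by (simp add: simple_graph_def)
  have path: "is_path (f e)" if "e \<in> edges G" for e
  proof -
    have "card e = 2"
      using assms that by (simp add: simple_graph_def)
    then obtain a b where ab: "e = {a, b}" "a \<noteq> b"
      unfolding card_2_iff by blast
    then have "f e = path_of [a, b]"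
      by (simp only: f_def path_of_pair)
    then show ?thesis
      unfolding is_path_def using ab(2) by (intro exI[of _ "[a, b]"]) simp
  qed
  have "{P \<in> f ` edges G. e \<in> edges P} = (if e \<in> edges G then {f e} else {})" for e
    unfolding f_def by auto
  then have "edge_sym_diff (f ` edges G) = edges G"
    by (simp add: edge_sym_diff_def)
  moreover have "vertices (f e) \<subseteq> vertices G" if "e \<in> edges G" for e
    using assms that by (auto simp: f_def simple_graph_def)
  ultimately have "path_odd_cover G (f ` edges G)"
    using fin path by (auto simp: path_odd_cover_def)
  then show ?thesis ..
qed

end

theory Submission
  imports Defs "HOL-Library.Multiset"
begin

text \<open>
  Put \<open>k = \<lceil>\<Delta>/2\<rceil>\<close> and orient the edges of \<open>G\<close> so that in- and outdegree
  differ by at most one everywhere. With suitable loops added, the orientation is a bipartite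
  multigraph of maximum degree at most \<open>k\<close> between out-copies and in-copies of the vertices.
  An equitable \<open>k\<close>-edge-colouring makes every colour class a partial injection, that is, a
  disjoint union of paths (possibly trivial) and cycles; here the numbers \<open>m\<^sub>i\<close> of paths sum to
  \<open>v_odd G / 2\<close> and differ by at most one. A class with \<open>m\<^sub>i\<close> paths is the symmetric difference
  of at most \<open>max 2 m\<^sub>i\<close> paths: one path strings all cycles, cut open, together, and a second one
  supplies the missing edges and uses the same links. As the \<open>m\<^sub>i\<close> are balanced, the numbers
  \<open>max 2 m\<^sub>i\<close> sum to \<open>max (2k) (v_odd G / 2)\<close>.
\<close>

section \<open>Excesses and balanced splits of arc multisets\<close>

text \<open>Outdegree minus indegree. If all arcs run from one side of a bipartition to the other,
  this is the degree up to sign, so the same splitting results serve orientations and bipartite edge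
  colourings.\<close>

definition excess :: "('v \<times> 'v) multiset \<Rightarrow> 'v \<Rightarrow> int" where
  "excess M v = (\<Sum>p\<in>#M. of_bool (fst p = v) - of_bool (snd p = v))"

lemma excess_simps [simp]:
  "excess {#} v = 0"
  "excess (add_mset p M) v = of_bool (fst p = v) - of_bool (snd p = v) + excess M v"
  "excess (M + N) v = excess M v + excess N v"
  by (simp_all add: excess_def)

lemma excess_sum: "excess (\<Sum>i\<in>I. F i) v = (\<Sum>i\<in>I. excess (F i) v)"
  by (induction I rule: infinite_finite_induct) auto

lemma excess_pos: "excess M v > 0 \<Longrightarrow> \<exists>p\<in>#M. fst p = v"
  by (induction M) (auto simp: of_bool_def split: if_splits)

lemma excess_neg: "excess M v < 0 \<Longrightarrow> \<exists>p\<in>#M. snd p = v"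
  by (induction M) (auto simp: of_bool_def split: if_splits)

definition balanced :: "('v \<times> 'v) multiset \<Rightarrow> ('v \<times> 'v) multiset \<Rightarrow> bool" where
  "balanced A B \<longleftrightarrow> (\<forall>v. \<bar>excess A v - excess B v\<bar> \<le> 1)"

text \<open>Undoes the replacement of two arcs by \<open>r\<close>: \<open>p\<close> takes the place
  of \<open>r\<close> and \<open>q\<close> joins the other side, so the difference of excesses stays
  the same at every vertex.\<close>

lemma balanced_split_off:
  assumes "add_mset r M = A + B" "balanced A B"
    and r: "\<And>v. excess {#r#} v = excess {#p#} v - excess {#q#} v"
  shows "\<exists>A B. add_mset p (add_mset q M) = A + B \<and> balanced A B"
proof -
  have "r \<in># A + B"
    using assms(1) by (metis union_single_eq_member add_mset_add_single)
  then consider A' where "A = add_mset r A'" | B' where "B = add_mset r B'"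
    by (metis mset_add union_iff)
  then show ?thesis
  proof cases
    case 1
    then have "add_mset p (add_mset q M) = add_mset p A' + add_mset q B"
      using assms(1) by simp
    moreover have "balanced (add_mset p A') (add_mset q B)"
      unfolding balanced_def
    proof
      fix v
      show "\<bar>excess (add_mset p A') v - excess (add_mset q B) v\<bar> \<le> 1"
        using assms(2)[unfolded balanced_def, rule_format, of v] r[of v] 1 by simp
    qed
    ultimately show ?thesis by blast
  next
    case 2
    then have "add_mset p (add_mset q M) = add_mset q A + add_mset p B'"
      using assms(1) by simp
    moreover have "balanced (add_mset q A) (add_mset p B')"
      unfolding balanced_def
    proof
      fix v
      show "\<bar>excess (add_mset q A) v - excess (add_mset p B') v\<bar> \<le> 1"
        using assms(2)[unfolded balanced_def, rule_format, of v] r[of v] 2 by simp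
    qed
    ultimately show ?thesis by blast
  qed
qed

text \<open>
  Two arcs leaving (or entering) a vertex \<open>v\<close> are replaced by one arc between their other ends:
  putting them on different sides makes their contributions at \<open>v\<close> cancel.
\<close>

lemma balanced_split: "\<exists>A B. M = A + B \<and> balanced A B"
proof (induction "size M" arbitrary: M rule: less_induct)
  case less
  show ?case
  proof (cases "\<forall>v. \<bar>excess M v\<bar> \<le> 1")
    case True
    then have "M = M + {#} \<and> balanced M {#}"
      by (simp add: balanced_def)
    then show ?thesis by blast
  next
    case False
    then obtain v where "\<not> \<bar>excess M v\<bar> \<le> 1"
      by blast
    then have "excess M v \<ge> 2 \<or> excess M v \<le> -2"
      by linarith
    then show ?thesis
    proof
      assume v: "excess M v \<ge> 2"
      then obtain p where "p \<in># M" "fst p = v"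
        using excess_pos[of M v] by auto
      then obtain M1 where p: "M = add_mset p M1" "fst p = v"
        by (metis mset_add)
      then have "excess M1 v > 0"
        using v by (auto simp: of_bool_def split: if_splits)
      then obtain q M2 where q: "M1 = add_mset q M2" "fst q = v"
        using excess_pos[of M1 v] by (metis mset_add)
      obtain A B where "add_mset (snd p, snd q) M2 = A + B" "balanced A B"
        using less[of "add_mset (snd p, snd q) M2"] p q by auto
      \<comment> \<open>The arc from \<open>snd p\<close> to \<open>snd q\<close> has the excess of
        \<open>q\<close> minus that of \<open>p\<close>, hence the exchanged roles of
        \<open>p\<close> and \<open>q\<close>.\<close>
      then have "\<exists>A B. add_mset q (add_mset p M2) = A + B \<and> balanced A B"
        by (rule balanced_split_off) (use p q in simp)
      then show ?thesis
        using p q by (simp add: add_mset_commute)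
    next
      assume v: "excess M v \<le> -2"
      then obtain p where "p \<in># M" "snd p = v"
        using excess_neg[of M v] by auto
      then obtain M1 where p: "M = add_mset p M1" "snd p = v"
        by (metis mset_add)
      then have "excess M1 v < 0"
        using v by (auto simp: of_bool_def split: if_splits)
      then obtain q M2 where q: "M1 = add_mset q M2" "snd q = v"
        using excess_neg[of M1 v] by (metis mset_add)
      obtain A B where "add_mset (fst p, fst q) M2 = A + B" "balanced A B"
        using less[of "add_mset (fst p, fst q) M2"] p q by auto
      then have "\<exists>A B. add_mset p (add_mset q M2) = A + B \<and> balanced A B"
        by (rule balanced_split_off) (use p q in simp)
      then show ?thesis
        using p q by simp
    qed
  qed
qed

text \<open>For a fixed sum, the sum of squares increases with the distance of the two numbers, and
  the parity of the sum makes a distance of at most one the smallest possible.\<close>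

lemma sum_squares_balanced:
  fixes a b c d :: int
  assumes "a + b = c + d" "\<bar>a - b\<bar> \<le> 1"
  shows "a\<^sup>2 + b\<^sup>2 \<le> c\<^sup>2 + d\<^sup>2"
    and "\<bar>c - d\<bar> > 1 \<Longrightarrow> a\<^sup>2 + b\<^sup>2 < c\<^sup>2 + d\<^sup>2"
proof -
  have id: "2 * (x\<^sup>2 + y\<^sup>2) = (x + y)\<^sup>2 + (x - y)\<^sup>2" for x y :: int
    by algebra
  have "\<bar>a - b\<bar> \<le> \<bar>c - d\<bar>"
    using assms by presburger
  then show "a\<^sup>2 + b\<^sup>2 \<le> c\<^sup>2 + d\<^sup>2"
    using id[of a b] id[of c d] assms(1) by (simp add: abs_le_square_iff)
  assume "\<bar>c - d\<bar> > 1"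
  then have "\<bar>a - b\<bar> < \<bar>c - d\<bar>"
    using assms(2) by linarith
  then have "(a - b)\<^sup>2 < (c - d)\<^sup>2"
    using power_strict_mono[of "\<bar>a - b\<bar>" "\<bar>c - d\<bar>" 2] by simp
  then show "a\<^sup>2 + b\<^sup>2 < c\<^sup>2 + d\<^sup>2"
    using id[of a b] id[of c d] assms(1) by simp
qed

text \<open>For bipartite arcs this is an equitable edge colouring. Among all splits, one with the
  least sum of squared excesses is taken; splitting the union of an unbalanced pair of classes
  afresh by \<open>balanced_split\<close> would lower this sum.\<close>

lemma equitable_split:
  fixes N :: "('v \<times> 'v) multiset" and k :: nat
  assumes "k > 0"
  shows "\<exists>F. (\<Sum>i<k. F i) = N \<and> (\<forall>i<k. \<forall>j<k. balanced (F i) (F j))"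
proof -
  define V where "V = fst ` set_mset N \<union> snd ` set_mset N"
  have "finite V"
    by (simp add: V_def)
  define \<Phi> :: "(nat \<Rightarrow> ('v \<times> 'v) multiset) \<Rightarrow> int" where
    "\<Phi> F = (\<Sum>i<k. \<Sum>v\<in>V. (excess (F i) v)\<^sup>2)" for F
  have "\<Phi> F \<ge> 0" for F
    unfolding \<Phi>_def by (intro sum_nonneg) simp
  have "(\<Sum>i<k. if i = 0 then N else {#}) = N"
    using assms by (simp add: sum.delta)
  then obtain F where F: "(\<Sum>i<k. F i) = N"
    and min: "\<And>F'. (\<Sum>i<k. F' i) = N \<Longrightarrow> nat (\<Phi> F) \<le> nat (\<Phi> F')"
    using ex_has_least_nat[of "\<lambda>F. (\<Sum>i<k. F i) = N" _ "\<lambda>F. nat (\<Phi> F)"] by blast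
  have "balanced (F i) (F j)" if "i < k" "j < k" for i j
  proof (rule ccontr)
    assume neg: "\<not> balanced (F i) (F j)"
    then obtain v where v: "\<bar>excess (F i) v - excess (F j) v\<bar> > 1"
      by (auto simp: balanced_def not_le)
    then have "i \<noteq> j" by auto
    obtain A B where AB: "F i + F j = A + B" "balanced A B"
      using balanced_split by blast
    define F' where "F' = F(i := A, j := B)"
    have split: "(\<Sum>l<k. f l) = f i + f j + (\<Sum>l\<in>{..<k} - {i} - {j}. f l)"
      for f :: "nat \<Rightarrow> 'b::comm_monoid_add"
      using that \<open>i \<noteq> j\<close> by (simp add: sum.remove[of _ i] sum.remove[of _ j] add.assoc)
    have rest: "(\<Sum>l\<in>{..<k} - {i} - {j}. f (F' l)) = (\<Sum>l\<in>{..<k} - {i} - {j}. f (F l))"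
      for f :: "_ \<Rightarrow> 'b::comm_monoid_add"
      by (rule sum.cong) (auto simp: F'_def)
    have F'ij: "F' i = A" "F' j = B"
      using \<open>i \<noteq> j\<close> by (auto simp: F'_def)
    have "(\<Sum>l<k. F' l) = N"
      using split[of F] split[of F'] rest[of "\<lambda>x. x"] F'ij AB(1) F by simp
    then have le: "\<Phi> F \<le> \<Phi> F'"
      using min \<open>\<And>F. \<Phi> F \<ge> 0\<close> by (metis nat_le_eq_zle order_antisym_conv linorder_not_le nle_le)
    have ex: "excess A w + excess B w = excess (F i) w + excess (F j) w" for w
      using AB(1) by (metis excess_simps(3))
    have bal: "\<bar>excess A w - excess B w\<bar> \<le> 1" for w
      using AB(2) by (simp add: balanced_def)
    \<comment> \<open>\<open>\<Phi>\<close> sums over the finite set \<open>V\<close> only, so the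
      strict decrease counts only if the vertex where balance fails lies in
      \<open>V\<close>.\<close>
    have "v \<in> V"
    proof (rule ccontr)
      assume "v \<notin> V"
      have "excess (F l) v = 0" if "l < k" for l
      proof -
        have "F l \<subseteq># N"
          unfolding F[symmetric] using that by (simp add: sum.remove[of _ l])
        then have "\<forall>p\<in>#F l. fst p \<noteq> v \<and> snd p \<noteq> v"
          using \<open>v \<notin> V\<close> by (auto simp: V_def dest: mset_subset_eqD)
        then show ?thesis
          using excess_pos excess_neg by (metis linorder_neqE)
      qed
      then show False
        using v that by simp
    qed
    have "(\<Sum>w\<in>V. (excess A w)\<^sup>2 + (excess B w)\<^sup>2)
        < (\<Sum>w\<in>V. (excess (F i) w)\<^sup>2 + (excess (F j) w)\<^sup>2)"
      using \<open>finite V\<close> \<open>v \<in> V\<close> sum_squares_balanced[OF ex bal] v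
      by (intro sum_strict_mono_ex1) auto
    then have "\<Phi> F' < \<Phi> F"
      unfolding \<Phi>_def split[of "\<lambda>l. \<Sum>v\<in>V. (excess (F l) v)\<^sup>2"] split[of "\<lambda>l. \<Sum>v\<in>V. (excess (F' l) v)\<^sup>2"]
        rest[of "\<lambda>x. \<Sum>v\<in>V. (excess x v)\<^sup>2"] F'ij by (simp add: sum.distrib)
    with le show False by simp
  qed
  with F show ?thesis by blast
qed

section \<open>Edge parities of vertex sequences\<close>

text \<open>A number and not a set, so that the symmetric difference of several sequences becomes
  the parity of a sum.\<close>

fun edge_count :: "'a set \<Rightarrow> 'a list \<Rightarrow> nat" where
  "edge_count e (x # y # zs) = of_bool ({x, y} = e) + edge_count e (y # zs)"
| "edge_count e _ = 0"

lemma edge_count_append: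
  "xs \<noteq> [] \<Longrightarrow> edge_count e (xs @ ys) = edge_count e xs + edge_count e (last xs # ys)"
  by (induction xs rule: induct_list012) auto

lemma edge_count_Cons:
  "xs \<noteq> [] \<Longrightarrow> edge_count e (x # xs) = of_bool ({x, hd xs} = e) + edge_count e xs"
  by (cases xs) auto

lemma edge_count_rev: "edge_count e (rev xs) = edge_count e xs"
proof (induction xs)
  case (Cons x xs)
  then show ?case
    by (cases "xs = []") (auto simp: edge_count_append edge_count_Cons last_rev insert_commute)
qed simp

text \<open>A cycle on two vertices counts its edge twice, in accordance with two antiparallel
  arcs.\<close>

definition cycle_edge_count :: "'a set \<Rightarrow> 'a list \<Rightarrow> nat" where
  "cycle_edge_count e xs = edge_count e xs + of_bool ({hd xs, last xs} = e)"

lemma edge_count_eq_0: "\<not> e \<subseteq> set xs \<Longrightarrow> edge_count e xs = 0"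
  by (induction xs rule: induct_list012) auto

lemma edges_path_of_Cons:
  "edges (path_of (x # y # zs)) = insert {x, y} (edges (path_of (y # zs)))"
proof -
  have "(\<exists>i. e = {(x # y # zs) ! i, (x # y # zs) ! Suc i} \<and> Suc i < length (x # y # zs)) \<longleftrightarrow>
    e = {x, y} \<or> (\<exists>i. e = {(y # zs) ! i, (y # zs) ! Suc i} \<and> Suc i < length (y # zs))"
    (is "(\<exists>i. ?P i) \<longleftrightarrow> _") for e
  proof -
    have "(\<exists>i. ?P i) \<longleftrightarrow> ?P 0 \<or> (\<exists>i. ?P (Suc i))"
      by (metis not0_implies_Suc)
    then show ?thesis by simp
  qed
  then show ?thesis
    by (auto simp: path_of_def)
qed

text \<open>A path never repeats an edge, so occurrence and odd multiplicity coincide.\<close>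

lemma edges_path_of: "distinct xs \<Longrightarrow> edges (path_of xs) = {e. odd (edge_count e xs)}"
proof (induction xs rule: induct_list012)
  case (3 x y zs)
  have "edge_count {x, y} (y # zs) = 0"
    using 3 by (intro edge_count_eq_0) auto
  then show ?case
    using 3 by (auto simp: edges_path_of_Cons)
qed (auto simp: path_of_def)

lemma edge_count_card: "distinct xs \<Longrightarrow> card e \<noteq> 2 \<Longrightarrow> edge_count e xs = 0"
  by (induction xs rule: induct_list012) auto

text \<open>Repeated paths cancel in pairs.\<close>

lemma path_list_to_set:
  assumes "\<And>L. L \<in> set Ls \<Longrightarrow> L \<noteq> [] \<and> distinct L \<and> set L \<subseteq> V"
  shows "\<exists>C. finite C \<and> card C \<le> length Ls \<and> (\<forall>P\<in>C. is_path P \<and> vertices P \<subseteq> V) \<and>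
    edge_sym_diff C = {e. odd (\<Sum>L\<leftarrow>Ls. edge_count e L)}"
  using assms
proof (induction Ls)
  case Nil
  show ?case
    by (intro exI[of _ "{}"]) (simp add: edge_sym_diff_empty)
next
  case (Cons L Ls)
  then obtain C where C: "finite C" "card C \<le> length Ls" "\<forall>P\<in>C. is_path P \<and> vertices P \<subseteq> V"
    "edge_sym_diff C = {e. odd (\<Sum>L\<leftarrow>Ls. edge_count e L)}"
    by auto
  let ?P = "path_of L"
  have P: "is_path ?P" "vertices ?P \<subseteq> V" "edges ?P = {e. odd (edge_count e L)}"
    using Cons.prems[of L] edges_path_of by (auto simp: is_path_def path_of_def)
  show ?case
  proof (cases "?P \<in> C")
    case True
    then have "edge_sym_diff C = sym_diff (edges ?P) (edge_sym_diff (C - {?P}))"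
      using edge_sym_diff_insert[of "C - {?P}" ?P] C(1) by (simp add: insert_absorb)
    then have "edge_sym_diff (C - {?P}) = sym_diff (edges ?P) (edge_sym_diff C)"
      by auto
    then show ?thesis
      using C P by (intro exI[of _ "C - {?P}"]) (auto simp: card_Diff_singleton_if)
  next
    case False
    then show ?thesis
      using C P edge_sym_diff_insert[of C ?P] by (intro exI[of _ "insert ?P C"]) auto
  qed
qed

section \<open>Covering disjoint paths and cycles by few paths\<close>

text \<open>An opened cycle lacks exactly the edge between its first and last vertex. The shortcut
  runs through these missing edges, passing from one to the next by the same links as
  \<open>concat Cs\<close>.\<close>

definition shortcut :: "'a list list \<Rightarrow> 'a list" where
  "shortcut Cs = concat (map (\<lambda>C. [hd C, last C]) Cs)"

lemma set_shortcut: "[] \<notin> set Cs \<Longrightarrow> set (shortcut Cs) \<subseteq> set (concat Cs)"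
  by (induction Cs) (auto simp: shortcut_def)

lemma distinct_shortcut:
  assumes "distinct (concat Cs)" "\<And>C. C \<in> set Cs \<Longrightarrow> C \<noteq> [] \<and> hd C \<noteq> last C"
  shows "distinct (shortcut Cs)"
  using assms
proof (induction Cs)
  case (Cons C Cs)
  have "set (shortcut Cs) \<subseteq> set (concat Cs)"
    using Cons.prems(2) by (intro set_shortcut) auto
  moreover have "shortcut (C # Cs) = hd C # last C # shortcut Cs"
    by (simp add: shortcut_def)
  moreover have "hd C \<in> set C" "last C \<in> set C"
    using Cons.prems(2)[of C] by auto
  moreover have "set C \<inter> set (concat Cs) = {}" "distinct (shortcut Cs)" "hd C \<noteq> last C"
    using Cons by auto
  ultimately show ?case
    by (metis (no_types, lifting) disjoint_iff distinct.simps(2) set_ConsD subsetD)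
qed (simp add: shortcut_def)

text \<open>The links between consecutive cycles are used by both paths and cancel.\<close>

lemma even_edge_count_shortcut:
  assumes "[] \<notin> set Cs"
  shows "even (edge_count e (a # concat Cs @ zs) + edge_count e (a # shortcut Cs @ zs)
    + (\<Sum>C\<leftarrow>Cs. cycle_edge_count e C))"
  using assms
proof (induction Cs arbitrary: a)
  case (Cons C Cs)
  have "C \<noteq> []" using Cons.prems by auto
  then have "edge_count e (a # concat (C # Cs) @ zs) =
      of_bool ({a, hd C} = e) + edge_count e C + edge_count e (last C # concat Cs @ zs)"
    by (simp add: edge_count_Cons edge_count_append)
  moreover have "edge_count e (a # shortcut (C # Cs) @ zs) =
      of_bool ({a, hd C} = e) + of_bool ({hd C, last C} = e) + edge_count e (last C # shortcut Cs @ zs)"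
    by (simp add: shortcut_def)
  moreover have "cycle_edge_count e C = edge_count e C + of_bool ({hd C, last C} = e)"
    by (rule cycle_edge_count_def)
  ultimately show ?case
    using Cons.IH[of "last C"] Cons.prems by auto
qed (simp add: shortcut_def)

text \<open>All cycles together cost two sequences, \<open>concat Cs\<close> and
  \<open>shortcut Cs\<close>. Given paths can be lengthened by these sequences, so extra paths are
  needed only if there are fewer than two.\<close>

lemma linear_and_cyclic_cover:
  assumes dist: "distinct (concat Ps @ concat Cs)" and "[] \<notin> set Ps"
    and cyc: "\<And>C. C \<in> set Cs \<Longrightarrow> C \<noteq> [] \<and> hd C \<noteq> last C"
  shows "\<exists>Ls. length Ls \<le> max 2 (length Ps) \<and>
    (\<forall>L\<in>set Ls. L \<noteq> [] \<and> distinct L \<and> set L \<subseteq> set (concat Ps @ concat Cs)) \<and>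
    (\<forall>e. even ((\<Sum>L\<leftarrow>Ls. edge_count e L) + (\<Sum>P\<leftarrow>Ps. edge_count e P)
      + (\<Sum>C\<leftarrow>Cs. cycle_edge_count e C)))"
proof -
  have ne: "[] \<notin> set Cs"
    using cyc by blast
  let ?D = "concat Cs" and ?S = "shortcut Cs"
  have S: "set ?S \<subseteq> set ?D" "distinct ?S"
    using set_shortcut[OF ne] distinct_shortcut[of Cs] dist cyc by auto
  consider "Ps = []" "Cs = []" | C Cs' where "Ps = []" "Cs = C # Cs'" | P where "Ps = [P]"
    | P Q Ps' where "Ps = P # Q # Ps'"
    by (metis neq_Nil_conv)
  then show ?thesis
  proof cases
    case 1
    then show ?thesis by (intro exI[of _ "[]"]) simp
  next
    case (2 C Cs')
    have C: "C \<noteq> []" "[] \<notin> set Cs'" using ne 2 by auto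
    have S_eq: "?S = hd C # last C # shortcut Cs'"
      using 2 by (simp add: shortcut_def)
    \<comment> \<open>No link leads to the first cycle. Behind it both sequences continue from
      \<open>last C\<close>, where the parity lemma applies to the remaining cycles.\<close>
    have "even ((\<Sum>L\<leftarrow>[?D, ?S]. edge_count e L) + (\<Sum>C\<leftarrow>Cs. cycle_edge_count e C))" for e
      using even_edge_count_shortcut[OF C(2), of e "last C" "[]"] C
        cycle_edge_count_def[of e C] unfolding S_eq
      by (auto simp: 2 edge_count_append)
    then show ?thesis
      using 2 C S S_eq dist by (intro exI[of _ "[?D, ?S]"]) auto
  next
    case (3 P)
    then have P: "P \<noteq> []" using assms(2) by auto
    then have "last P \<in> set P" by simp
    \<comment> \<open>Both sequences visit the cycles starting from \<open>last P\<close>, so the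
      link to the first cycle cancels as well.\<close>
    have "even ((\<Sum>L\<leftarrow>[P @ ?D, last P # ?S]. edge_count e L) + edge_count e P
        + (\<Sum>C\<leftarrow>Cs. cycle_edge_count e C))" for e
      using even_edge_count_shortcut[OF ne, of e "last P" "[]"] P
      by (auto simp: edge_count_append)
    moreover have "last P \<notin> set ?S"
      using \<open>last P \<in> set P\<close> S(1) dist 3 by auto
    ultimately show ?thesis
      using 3 P S dist
      by (intro exI[of _ "[P @ ?D, last P # ?S]"]) auto
  next
    case (4 P Q Ps')
    then have PQ: "P \<noteq> []" "Q \<noteq> []" using assms(2) by auto
    then have last: "last P \<in> set P" "last Q \<in> set Q" by auto
    \<comment> \<open>These two replace \<open>P\<close> and \<open>Q\<close>. Both contain a tour
      between \<open>last P\<close> and \<open>last Q\<close>, one through the opened cycles and the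
      other backwards through the shortcut; the links to these two end vertices therefore cancel
      too.\<close>
    let ?L1 = "P @ ?D @ [last Q]" and ?L2 = "Q @ rev ?S @ [last P]"
    have "edge_count e (last Q # rev ?S @ [last P]) = edge_count e (last P # ?S @ [last Q])" for e
      using edge_count_rev[of e "last P # ?S @ [last Q]"] by simp
    then have sum: "(\<Sum>L\<leftarrow>?L1 # ?L2 # Ps'. edge_count e L) + (\<Sum>P\<leftarrow>Ps. edge_count e P)
        + (\<Sum>C\<leftarrow>Cs. cycle_edge_count e C) =
        edge_count e (last P # ?D @ [last Q]) + edge_count e (last P # ?S @ [last Q])
        + (\<Sum>C\<leftarrow>Cs. cycle_edge_count e C) + 2 * (\<Sum>P\<leftarrow>Ps. edge_count e P)" for e
      using PQ by (simp add: edge_count_append 4)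
    have even: "even ((\<Sum>L\<leftarrow>?L1 # ?L2 # Ps'. edge_count e L) + (\<Sum>P\<leftarrow>Ps. edge_count e P)
        + (\<Sum>C\<leftarrow>Cs. cycle_edge_count e C))" for e
      unfolding sum by (intro dvd_add even_edge_count_shortcut[OF ne] dvd_triv_left)
    have "distinct P" "distinct Q" "distinct ?D" "set P \<inter> set Q = {}"
        "set P \<inter> set ?D = {}" "set Q \<inter> set ?D = {}"
      using dist unfolding 4 by auto
    then have "distinct ?L1" "distinct ?L2"
      using S last by auto
    moreover have "\<forall>L\<in>set Ps'. distinct L"
      using dist unfolding 4 by (simp add: distinct_concat_iff)
    moreover have "\<forall>L\<in>set Ps'. L \<noteq> []" using assms(2) 4 by auto
    ultimately have distinct: "\<forall>L\<in>set (?L1 # ?L2 # Ps'). L \<noteq> [] \<and> distinct L"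
      using PQ by simp
    have "set ?L1 \<subseteq> set (concat Ps @ concat Cs)" "set ?L2 \<subseteq> set (concat Ps @ concat Cs)"
      using S(1) last unfolding 4 by auto
    moreover have "\<forall>L\<in>set Ps'. set L \<subseteq> set (concat Ps @ concat Cs)"
      unfolding 4 by auto
    ultimately have verts: "\<forall>L\<in>set (?L1 # ?L2 # Ps'). set L \<subseteq> set (concat Ps @ concat Cs)"
      by (simp del: set_append set_concat)
    have len: "length (?L1 # ?L2 # Ps') \<le> max 2 (length Ps)"
      using 4 by simp
    show ?thesis
      by (rule exI[of _ "?L1 # ?L2 # Ps'"], intro conjI allI ballI)
        (use len even distinct verts in \<open>blast+\<close>)
  qed
qed

section \<open>Partial injections as disjoint paths and cycles\<close>

text \<open>Multiplicities in \<open>mset_set V\<close> are at most one, so for a concatenation the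
  containment expresses both that each sequence is simple and that they are pairwise
  disjoint.\<close>

lemma distinct_if_mset_subseteq:
  assumes "finite V" "mset xs \<subseteq># mset_set V"
  shows "distinct xs" "set xs \<subseteq> V"
proof -
  have le: "count (mset xs) x \<le> count (mset_set V) x" for x
    using assms(2) by (rule mset_subset_eq_count)
  moreover have "count (mset_set V) x \<le> 1" for x
    using assms(1) by (cases "x \<in> V") auto
  ultimately have "count (mset xs) x \<le> 1" for x
    using order_trans by blast
  then have "count (mset xs) x = (if x \<in> set xs then 1 else 0)" for x
    by (simp add: le_antisym Suc_le_eq not_in_iff)
  then show "distinct xs"
    by (simp add: distinct_count_atmost_1)
  show "set xs \<subseteq> V"
    using set_mset_mono[OF assms(2)] assms(1) by simp
qed

text \<open>Arcs are inserted one by one, beginning with a trivial path at every vertex. The path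
  ends are the vertices without outgoing arc, the path starts those without incoming arc; a new arc
  joins two paths or closes one path to a cycle.\<close>

lemma linear_and_cyclic_decomposition:
  fixes F :: "('a \<times> 'a) multiset"
  assumes "finite V" "image_mset fst F \<subseteq># mset_set V" "image_mset snd F \<subseteq># mset_set V"
  shows "\<exists>Ps Cs. [] \<notin># Ps \<and> (\<forall>C\<in>#Cs. C \<noteq> [] \<and> hd C \<noteq> last C) \<and>
    (\<Sum>P\<in>#Ps + Cs. mset P) \<subseteq># mset_set V \<and>
    image_mset last Ps + image_mset fst F = mset_set V \<and>
    image_mset hd Ps + image_mset snd F = mset_set V \<and>
    (\<forall>e. card e = 2 \<longrightarrow> (\<Sum>P\<in>#Ps. edge_count e P) + (\<Sum>C\<in>#Cs. cycle_edge_count e C) =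
      size {#p \<in># F. {fst p, snd p} = e#})"
  using assms(2,3)
proof (induction F)
  case empty
  have "(\<Sum>v\<in>#mset_set V. {#v#}) = mset_set V"
    by (simp add: sum_mset_singleton_mset)
  then have sing: "(\<Sum>P\<in>#image_mset (\<lambda>v. [v]) (mset_set V) + {#}. mset P) = mset_set V"
    by (simp add: image_mset.compositionality comp_def)
  show ?case
    by (rule exI[of _ "image_mset (\<lambda>v. [v]) (mset_set V)"], rule exI[of _ "{#}"], unfold sing)
      (auto simp: image_mset.compositionality comp_def)
next
  case (add p F)
  obtain u v where p: "p = (u, v)" by force
  have "image_mset fst F \<subseteq># mset_set V" "image_mset snd F \<subseteq># mset_set V"
    using add.prems by (auto dest!: mset_subset_eq_insertD intro: subset_mset.less_imp_le)
  then obtain Ps Cs where IH: "[] \<notin># Ps"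
    "\<forall>C\<in>#Cs. C \<noteq> [] \<and> hd C \<noteq> last C"
    "(\<Sum>P\<in>#Ps + Cs. mset P) \<subseteq># mset_set V"
    "image_mset last Ps + image_mset fst F = mset_set V"
    "image_mset hd Ps + image_mset snd F = mset_set V"
    "\<forall>e. card e = 2 \<longrightarrow> (\<Sum>P\<in>#Ps. edge_count e P) + (\<Sum>C\<in>#Cs. cycle_edge_count e C) =
      size {#p \<in># F. {fst p, snd p} = e#}"
    using add.IH by blast
  \<comment> \<open>The new arc still fits into \<open>V\<close>, so \<open>u\<close> has no
    outgoing arc in \<open>F\<close> and is the end of a path. Dually, \<open>v\<close> is the start
    of one.\<close>
  have "{#u#} + image_mset fst F \<subseteq># image_mset last Ps + image_mset fst F"
    using add.prems(1) unfolding IH(4) by (simp add: p)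
  then have "u \<in># image_mset last Ps"
    by (simp only: subset_mset.add_le_cancel_right single_subset_iff)
  then obtain P where P: "P \<in># Ps" "last P = u" by auto
  have "{#v#} + image_mset snd F \<subseteq># image_mset hd Ps + image_mset snd F"
    using add.prems(2) unfolding IH(5) by (simp add: p)
  then have "v \<in># image_mset hd Ps"
    by (simp only: subset_mset.add_le_cancel_right single_subset_iff)
  then obtain Q where Q: "Q \<in># Ps" "hd Q = v" by auto
  have count_add: "size {#p \<in># add_mset p F. {fst p, snd p} = e#} =
      of_bool ({u, v} = e) + size {#p \<in># F. {fst p, snd p} = e#}" for e
    by (simp add: p)
  show ?case
  proof (cases "P = Q")
    case True
    obtain Ps' where Ps': "Ps = add_mset P Ps'"
      using P(1) by (metis mset_add)
    have PQ: "last P = u" "hd P = v" using P Q True by auto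
    have "P \<noteq> []" using IH(1) Ps' by auto
    show ?thesis
    proof (cases "u = v")
      case loop: True
      have sub: "mset P + (\<Sum>P\<in>#Ps' + Cs. mset P) \<subseteq># mset_set V"
        using IH(3) by (simp add: Ps')
      then have "mset P \<subseteq># mset_set V"
        by (rule subset_mset.order_trans[OF mset_subset_eq_add_left])
      then have "distinct P"
        using distinct_if_mset_subseteq[OF assms(1)] by blast
      \<comment> \<open>A loop can only close a trivial path. This path is dropped, which is why the
        sequences are claimed to lie within \<open>V\<close> but not to exhaust it.\<close>
      then have "P = [u]"
        using PQ loop \<open>P \<noteq> []\<close> by (cases P) (auto split: if_splits)
      then have no_edge: "edge_count e P = 0" for e by simp
      have no_loop: "card e = 2 \<Longrightarrow> {u, v} \<noteq> e" for e
        using loop by auto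
      have verts: "(\<Sum>P\<in>#Ps' + Cs. mset P) \<subseteq># mset_set V"
        by (rule subset_mset.order_trans[OF mset_subset_eq_add_right sub])
      show ?thesis
        unfolding count_add
        by (rule exI[of _ "Ps'"], rule exI[of _ "Cs"])
          (use IH PQ verts no_edge no_loop loop in \<open>simp add: p Ps'\<close>)
    next
      case False
      have verts: "(\<Sum>P\<in>#Ps' + add_mset P Cs. mset P) = (\<Sum>P\<in>#Ps + Cs. mset P)"
        by (simp add: Ps')
      have count: "cycle_edge_count e P = edge_count e P + of_bool ({u, v} = e)" for e
        by (simp add: cycle_edge_count_def PQ insert_commute)
      show ?thesis
        unfolding count_add
        by (rule exI[of _ "Ps'"], rule exI[of _ "add_mset P Cs"], unfold verts)
          (use IH PQ False \<open>P \<noteq> []\<close> in \<open>auto simp: p Ps' count add_ac\<close>)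
    qed
  next
    case False
    then obtain Ps' where Ps': "Ps = add_mset P (add_mset Q Ps')"
      using P(1) Q(1) by (metis insert_noteq_member mset_add)
    then have ne: "P \<noteq> []" "Q \<noteq> []" using IH(1) by auto
    have count: "edge_count e (P @ Q) = edge_count e P + of_bool ({u, v} = e) + edge_count e Q" for e
      using ne P Q by (simp add: edge_count_append edge_count_Cons)
    have verts: "(\<Sum>P\<in>#add_mset (P @ Q) Ps' + Cs. mset P) = (\<Sum>P\<in>#Ps + Cs. mset P)"
      by (simp add: Ps')
    show ?thesis
      unfolding count_add
      by (rule exI[of _ "add_mset (P @ Q) Ps'"], rule exI[of _ "Cs"], unfold verts)
        (use IH P Q ne in \<open>auto simp: p Ps' count add_ac add_mset_commute\<close>)
  qed
qed

text \<open>Each path contains exactly one vertex without outgoing arc, so \<open>m\<close> is the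
  number of paths in the decomposition. Restricting to two-element sets makes loops of
  \<open>F\<close> invisible.\<close>

lemma partial_injection_cover:
  fixes F :: "('a \<times> 'a) multiset"
  assumes "finite V" "image_mset fst F \<subseteq># mset_set V" "image_mset snd F \<subseteq># mset_set V"
    and m: "size F + m = card V"
  shows "\<exists>Ls. length Ls \<le> max 2 m \<and> (\<forall>L\<in>set Ls. L \<noteq> [] \<and> distinct L \<and> set L \<subseteq> V) \<and>
    (\<forall>e. card e = 2 \<longrightarrow>
      even ((\<Sum>L\<leftarrow>Ls. edge_count e L) + size {#p \<in># F. {fst p, snd p} = e#}))"
proof -
  obtain Ps' Cs' where D: "[] \<notin># Ps'" "\<forall>C\<in>#Cs'. C \<noteq> [] \<and> hd C \<noteq> last C"
    "(\<Sum>P\<in>#Ps' + Cs'. mset P) \<subseteq># mset_set V"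
    "image_mset last Ps' + image_mset fst F = mset_set V"
    "\<forall>e. card e = 2 \<longrightarrow> (\<Sum>P\<in>#Ps'. edge_count e P) + (\<Sum>C\<in>#Cs'. cycle_edge_count e C) =
      size {#p \<in># F. {fst p, snd p} = e#}"
    using linear_and_cyclic_decomposition[OF assms(1-3)] by blast
  obtain Ps Cs where lists: "Ps' = mset Ps" "Cs' = mset Cs"
    using ex_mset by metis
  have "size Ps' + size F = card V"
    using arg_cong[OF D(4), of size] assms(1) by simp
  then have len: "length Ps = m"
    using m lists by simp
  have "mset (concat Ps @ concat Cs) \<subseteq># mset_set V"
    using D(3) by (simp add: lists mset_concat sum_mset_sum_list flip: mset_map)
  note verts = distinct_if_mset_subseteq[OF assms(1) this]
  obtain Ls where Ls: "length Ls \<le> max 2 (length Ps)"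
    "\<forall>L\<in>set Ls. L \<noteq> [] \<and> distinct L \<and> set L \<subseteq> set (concat Ps @ concat Cs)"
    "\<And>e. even ((\<Sum>L\<leftarrow>Ls. edge_count e L) + (\<Sum>P\<leftarrow>Ps. edge_count e P)
      + (\<Sum>C\<leftarrow>Cs. cycle_edge_count e C))"
    using linear_and_cyclic_cover[OF verts(1)] D(1,2) unfolding lists set_mset_mset by blast
  have "even ((\<Sum>L\<leftarrow>Ls. edge_count e L) + size {#p \<in># F. {fst p, snd p} = e#})"
    if "card e = 2" for e
  proof -
    have "size {#p \<in># F. {fst p, snd p} = e#} =
        (\<Sum>P\<leftarrow>Ps. edge_count e P) + (\<Sum>C\<leftarrow>Cs. cycle_edge_count e C)"
      using D(5) that by (simp add: lists sum_mset_sum_list flip: mset_map)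
    then show ?thesis
      using Ls(3)[of e] by (simp only: add.assoc)
  qed
  moreover have "\<forall>L\<in>set Ls. L \<noteq> [] \<and> distinct L \<and> set L \<subseteq> V"
    using Ls(2) verts(2) by blast
  ultimately show ?thesis
    using Ls(1) len by blast
qed

section \<open>Balanced orientations and equitable colour classes\<close>

lemma excess_eq_count:
  "excess M v = int (count (image_mset fst M) v) - int (count (image_mset snd M) v)"
  by (induction M) auto

lemma excess_swap: "excess (image_mset prod.swap M) v = - excess M v"
  by (induction M) auto

lemma finite_edges: "simple_graph G \<Longrightarrow> finite (edges G)"
  unfolding simple_graph_def by (meson PowI finite_Pow_iff finite_subset subsetI)

text \<open>Orient arbitrarily, split the arcs into balanced halves and reverse one half: the excess
  becomes the difference of the two excesses.\<close>

lemma balanced_orientation: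
  assumes "simple_graph G"
  shows "\<exists>M. image_mset (\<lambda>p. {fst p, snd p}) M = mset_set (edges G) \<and> (\<forall>v. \<bar>excess M v\<bar> \<le> 1)"
proof -
  have "\<exists>p. e = {fst p, snd p}" if "e \<in> edges G" for e
  proof -
    have "card e = 2"
      using assms that by (simp add: simple_graph_def)
    then obtain a b where "e = {a, b}"
      unfolding card_2_iff by blast
    then have "e = {fst (a, b), snd (a, b)}" by simp
    then show ?thesis by blast
  qed
  then obtain f where f: "\<And>e. e \<in> edges G \<Longrightarrow> {fst (f e), snd (f e)} = e"
    by metis
  obtain A B where AB: "image_mset f (mset_set (edges G)) = A + B" "balanced A B"
    using balanced_split by blast
  let ?M = "A + image_mset prod.swap B"
  let ?u = "\<lambda>p. {fst p, snd p}"
  have "image_mset ?u (image_mset prod.swap B) = image_mset ?u B"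
    by (simp add: image_mset.compositionality comp_def insert_commute)
  then have "image_mset ?u ?M = image_mset ?u (image_mset f (mset_set (edges G)))"
    by (simp add: AB(1))
  also have "\<dots> = image_mset (\<lambda>e. e) (mset_set (edges G))"
    unfolding image_mset.compositionality comp_def
    by (rule image_mset_cong) (simp add: f finite_edges[OF assms])
  finally have "image_mset ?u ?M = mset_set (edges G)" by simp
  moreover have "\<bar>excess ?M v\<bar> \<le> 1" for v
    using AB(2) by (simp add: balanced_def excess_swap)
  ultimately show ?thesis by blast
qed

text \<open>If one value exceeded \<open>c\<close>, the others would be at least \<open>c\<close>
  and the sum too large. Applied to negated values it gives lower bounds.\<close>

lemma bounded_if_balanced:
  fixes x :: "nat \<Rightarrow> int"
  assumes "\<forall>i<k. \<forall>j<k. \<bar>x i - x j\<bar> \<le> 1" "(\<Sum>i<k. x i) \<le> int k * c" "i < k"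
  shows "x i \<le> c"
proof (rule ccontr)
  assume "\<not> x i \<le> c"
  then have "c \<le> x j" if "j < k" for j
    using assms(1,3) that by (smt (verit))
  then have "(\<Sum>j<k. c) < (\<Sum>j<k. x j)"
    using assms(3) \<open>\<not> x i \<le> c\<close>
    by (intro sum_strict_mono_ex1 bexI[of _ i]) auto
  then show False
    using assms(2) by simp
qed

text \<open>
  Out-copies are \<open>Inl v\<close> and in-copies \<open>Inr (Some v)\<close>. The extra vertex \<open>Inr None\<close> absorbs the
  deficit of the vertices with smaller out- than indegree, so that balancing the colours at it
  balances the numbers of paths.
\<close>

definition arc :: "'a \<times> 'a \<Rightarrow> ('a + 'a option) \<times> ('a + 'a option)" where
  "arc p = (Inl (fst p), Inr (Some (snd p)))"

definition free_arc :: "'a \<Rightarrow> ('a + 'a option) \<times> ('a + 'a option)" where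
  "free_arc v = (Inl v, Inr None)"

lemma excess_arcs:
  "excess (image_mset arc M) (Inl u) = int (count (image_mset fst M) u)"
  "excess (image_mset arc M) (Inr (Some w)) = - int (count (image_mset snd M) w)"
  "excess (image_mset arc M) (Inr None) = 0"
  by (induction M) (auto simp: arc_def)

lemma excess_free_arcs:
  "excess (image_mset free_arc S) (Inl u) = int (count S u)"
  "excess (image_mset free_arc S) (Inr (Some w)) = 0"
  "excess (image_mset free_arc S) (Inr None) = - int (size S)"
  by (induction S) (auto simp: free_arc_def)

lemma arcs_split:
  "set_mset X \<subseteq> range arc \<union> range free_arc \<Longrightarrow> \<exists>R S. X = image_mset arc R + image_mset free_arc S"
proof (induction X)
  case (add x X)
  then obtain R S where RS: "X = image_mset arc R + image_mset free_arc S" by auto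
  from add.prems consider p where "x = arc p" | v where "x = free_arc v" by auto
  then show ?case
  proof cases
    case 1
    then have "add_mset x X = image_mset arc (add_mset p R) + image_mset free_arc S"
      by (simp add: RS)
    then show ?thesis by blast
  next
    case 2
    then have "add_mset x X = image_mset arc R + image_mset free_arc (add_mset v S)"
      by (simp add: RS)
    then show ?thesis by blast
  qed
qed simp

text \<open>Only free arcs enter \<open>Inr None\<close>, so removing these and decoding the rest
  recovers \<open>R\<close>.\<close>

lemma arcs_inject:
  assumes "image_mset arc R + image_mset free_arc S = image_mset arc R' + image_mset free_arc S'"
  shows "R = R'"
proof -
  let ?g = "\<lambda>X. image_mset (\<lambda>x. (projl (fst x), the (projr (snd x)))) {#x \<in># X. snd x \<noteq> Inr None#}"
  have g: "?g (image_mset arc R + image_mset free_arc S) = R" for R :: "('a \<times> 'a) multiset" and S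
    by (simp add: filter_mset_image_mset image_mset.compositionality comp_def arc_def free_arc_def)
  have "R = ?g (image_mset arc R + image_mset free_arc S)"
    by (rule g[symmetric])
  also have "\<dots> = R'"
    unfolding assms by (rule g)
  finally show ?thesis .
qed

lemma image_mset_sum: "image_mset f (\<Sum>i\<in>I. F i) = (\<Sum>i\<in>I. image_mset f (F i))"
  by (induction I rule: infinite_finite_induct) auto

lemma balanced_partial_injections:
  fixes M :: "('a \<times> 'a) multiset"
  assumes "finite V"
    and V: "set_mset M \<subseteq> V \<times> V"
    and excess: "\<And>v. \<bar>excess M v\<bar> \<le> 1"
    and deg: "\<And>v. count (image_mset fst M) v \<le> k" "\<And>v. count (image_mset snd M) v \<le> k"
  shows "\<exists>F L m. (\<Sum>i<k. F i) = M + L \<and> (\<forall>p\<in>#L. fst p = snd p) \<and>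
    (\<forall>i<k. image_mset fst (F i) \<subseteq># mset_set V \<and> image_mset snd (F i) \<subseteq># mset_set V \<and>
      size (F i) + m i = card V) \<and>
    (\<Sum>i<k. m i) = card {v \<in> V. excess M v = -1} \<and>
    (\<forall>i<k. \<forall>j<k. \<bar>int (m i) - int (m j)\<bar> \<le> 1)"
proof (cases "k = 0")
  case True
  then have "image_mset fst M = {#}"
    using deg(1) by (intro multiset_eqI) simp
  then show ?thesis
    using True by (intro exI[of _ "\<lambda>_. {#}"] exI[of _ "{#}"] exI[of _ "\<lambda>_. 0"]) simp
next
  case False
  define out where "out v = count (image_mset fst M) v" for v
  define inn where "inn v = count (image_mset snd M) v" for v
  have ex: "excess M v = int (out v) - int (inn v)" for v
    by (simp add: excess_eq_count out_def inn_def)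
  have outside: "out v = 0" "inn v = 0" if "v \<notin> V" for v
    using V that by (force simp: out_def inn_def count_eq_zero_iff)+
  \<comment> \<open>The loops raise the larger of out- and indegree to exactly \<open>k\<close>. A
    vertex of excess -1 then lacks one outgoing arc, which its free arc supplies; thus every
    out-copy of a vertex in \<open>V\<close> has degree \<open>k\<close>, and every in-copy at most
    \<open>k\<close>.\<close>
  define L where "L = (\<Sum>v\<in>V. replicate_mset (k - max (out v) (inn v)) (v, v))"
  define T where "T = {v \<in> V. excess M v = -1}"
  define N where "N = image_mset arc (M + L) + image_mset free_arc (mset_set T)"
  have "\<forall>p\<in>#(\<Sum>v\<in>A. replicate_mset (f v) (v, v)). fst p = snd p" for A :: "'a set" and f
    by (induction A rule: infinite_finite_induct) auto
  then have L_loop: "\<forall>p\<in>#L. fst p = snd p"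
    unfolding L_def .
  have count_L: "count (image_mset fst L) v = (if v \<in> V then k - max (out v) (inn v) else 0)"
    "count (image_mset snd L) v = (if v \<in> V then k - max (out v) (inn v) else 0)" for v
    using \<open>finite V\<close> by (auto simp: L_def image_mset_sum count_sum sum.delta)
  have ex_left: "excess N (Inl v) = (if v \<in> V then int k else 0)" for v
    using excess[of v] deg[of v] outside[of v] \<open>finite V\<close> unfolding N_def T_def
    by (auto simp: excess_arcs excess_free_arcs count_L count_mset_set' ex max_def
        simp flip: out_def inn_def)
  have ex_right: "- excess N (Inr (Some v)) \<le> (if v \<in> V then int k else 0)" for v
    using deg[of v] outside[of v] unfolding N_def
    by (auto simp: excess_arcs excess_free_arcs count_L max_def simp flip: out_def inn_def)
  have ex_None: "- excess N (Inr None) = int (card T)"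
    by (simp add: N_def excess_arcs excess_free_arcs)
  obtain X where X: "(\<Sum>i<k. X i) = N" "\<forall>i<k. \<forall>j<k. balanced (X i) (X j)"
    using equitable_split[of k N] False by auto
  have sum_X: "(\<Sum>i<k. excess (X i) v) = excess N v" for v
    using X(1) excess_sum by metis
  have bal: "\<forall>i<k. \<forall>j<k. \<bar>excess (X i) v - excess (X j) v\<bar> \<le> 1"
    "\<forall>i<k. \<forall>j<k. \<bar>- excess (X i) v - - excess (X j) v\<bar> \<le> 1" for v
    using X(2) unfolding balanced_def by (auto simp: abs_minus_commute)
  have "\<exists>R S. X i = image_mset arc R + image_mset free_arc S" if "i < k" for i
  proof (rule arcs_split)
    have "X i \<subseteq># N"
      unfolding X(1)[symmetric] using that by (simp add: sum.remove[of _ i])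
    then have "set_mset (X i) \<subseteq> set_mset N"
      by (rule set_mset_mono)
    also have "\<dots> \<subseteq> range arc \<union> range free_arc"
      by (auto simp: N_def)
    finally show "set_mset (X i) \<subseteq> range arc \<union> range free_arc" .
  qed
  then obtain F S where FS: "\<And>i. i < k \<Longrightarrow> X i = image_mset arc (F i) + image_mset free_arc (S i)"
    by metis
  have "(\<Sum>i<k. X i) = image_mset arc (\<Sum>i<k. F i) + image_mset free_arc (\<Sum>i<k. S i)"
    by (simp add: FS image_mset_sum sum.distrib)
  then have "image_mset arc (\<Sum>i<k. F i) + image_mset free_arc (\<Sum>i<k. S i) =
      image_mset arc (M + L) + image_mset free_arc (mset_set T)"
    by (simp add: X(1) N_def)
  then have sum_F: "(\<Sum>i<k. F i) = M + L"
    by (rule arcs_inject)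
  have class_i: "image_mset fst (F i) \<subseteq># mset_set V \<and> image_mset snd (F i) \<subseteq># mset_set V \<and>
      size (F i) + size (S i) = card V" if "i < k" for i
  proof -
    \<comment> \<open>The \<open>k\<close> arcs at the out-copy are spread evenly over
      \<open>k\<close> classes, so each class receives exactly one.\<close>
    have "excess (X i) (Inl v) = (if v \<in> V then 1 else 0)" for v
    proof (rule antisym)
      show "excess (X i) (Inl v) \<le> (if v \<in> V then 1 else 0)"
        by (rule bounded_if_balanced[OF bal(1) _ that]) (simp add: sum_X ex_left)
      have "- excess (X i) (Inl v) \<le> - (if v \<in> V then 1 else 0)"
        by (rule bounded_if_balanced[OF bal(2) _ that]) (simp add: sum_negf sum_X ex_left)
      then show "(if v \<in> V then 1 else 0) \<le> excess (X i) (Inl v)" by simp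
    qed
    then have "int (count (image_mset fst (F i) + S i) v) = int (count (mset_set V) v)" for v
      using \<open>finite V\<close> by (simp add: FS[OF that] excess_arcs excess_free_arcs count_mset_set')
    then have left: "image_mset fst (F i) + S i = mset_set V"
      by (intro multiset_eqI) (simp only: of_nat_eq_iff)
    have le: "- excess (X i) (Inr (Some v)) \<le> (if v \<in> V then 1 else 0)" for v
      using ex_right[of v]
      by (intro bounded_if_balanced[OF bal(2) _ that]) (auto simp: sum_negf sum_X)
    have "int (count (image_mset snd (F i)) v) \<le> int (count (mset_set V) v)" for v
      using \<open>finite V\<close> le[of v]
      by (auto simp: FS[OF that] excess_arcs excess_free_arcs count_mset_set' split: if_splits)
    then have right: "image_mset snd (F i) \<subseteq># mset_set V"
      by (intro mset_subset_eqI) (simp only: of_nat_le_iff)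
    have "image_mset fst (F i) \<subseteq># mset_set V"
      using mset_subset_eq_add_left[of "image_mset fst (F i)" "S i"] unfolding left .
    moreover have "size (F i) + size (S i) = card V"
      using arg_cong[OF left, of size] by simp
    ultimately show ?thesis
      using right by blast
  qed
  \<comment> \<open>The free arcs of a class mark the vertices without outgoing arc in
    \<open>F i\<close>, hence count its paths; balance at \<open>Inr None\<close> carries over to
    these numbers.\<close>
  have size_S: "int (size (S i)) = - excess (X i) (Inr None)" if "i < k" for i
    by (simp add: FS[OF that] excess_arcs excess_free_arcs)
  have "int (\<Sum>i<k. size (S i)) = (\<Sum>i<k. - excess (X i) (Inr None))"
    unfolding of_nat_sum by (rule sum.cong) (simp_all add: size_S)
  also have "\<dots> = int (card T)"
    using ex_None by (simp add: sum_negf sum_X)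
  finally have "(\<Sum>i<k. size (S i)) = card T"
    by (simp only: of_nat_eq_iff)
  moreover have "\<forall>i<k. \<forall>j<k. \<bar>int (size (S i)) - int (size (S j))\<bar> \<le> 1"
    using bal(2) by (simp add: size_S)
  ultimately show ?thesis
    using sum_F L_loop class_i unfolding T_def
    by (intro exI[of _ F] exI[of _ L] exI[of _ "\<lambda>i. size (S i)"]) simp
qed

section \<open>Counting and assembling the paths\<close>

text \<open>Balanced numbers lie on one common side of 2: all are at most 2 if their mean is, and
  all are at least 2 otherwise.\<close>

lemma sum_max_balanced:
  fixes m :: "nat \<Rightarrow> nat"
  assumes bal: "\<forall>i<k. \<forall>j<k. \<bar>int (m i) - int (m j)\<bar> \<le> 1"
  shows "(\<Sum>i<k. max 2 (m i)) = max (2 * k) (\<Sum>i<k. m i)"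
proof (cases "(\<Sum>i<k. m i) \<le> 2 * k")
  case True
  then have "(\<Sum>i<k. int (m i)) \<le> int k * 2"
    by (simp flip: of_nat_sum)
  then have "m i \<le> 2" if "i < k" for i
    using bounded_if_balanced[OF bal _ that, of 2] by simp
  then have "(\<Sum>i<k. max 2 (m i)) = (\<Sum>i<k. 2)"
    by (intro sum.cong) auto
  then show ?thesis
    using True by simp
next
  case False
  then have "(\<Sum>i<k. - int (m i)) \<le> int k * (- 2)"
    by (simp add: sum_negf flip: of_nat_sum)
  moreover have "\<forall>i<k. \<forall>j<k. \<bar>- int (m i) - - int (m j)\<bar> \<le> 1"
    using bal by (simp add: abs_minus_commute)
  ultimately have "2 \<le> m i" if "i < k" for i
    using bounded_if_balanced[of k "\<lambda>i. - int (m i)" "- 2" i] that by simp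
  then have "(\<Sum>i<k. max 2 (m i)) = (\<Sum>i<k. m i)"
    by (intro sum.cong) auto
  then show ?thesis
    using False by simp
qed

lemma size_filter_incident:
  "\<forall>p\<in>#M. fst p \<noteq> snd p \<Longrightarrow> size {#p \<in># M. v \<in> {fst p, snd p}#} =
    count (image_mset fst M) v + count (image_mset snd M) v"
  by (induction M) auto

text \<open>The excesses sum to zero and lie between -1 and 1, so the values 1 and -1 occur equally
  often; these are the odd ones.\<close>

lemma card_unbalanced:
  fixes M :: "('a \<times> 'a) multiset"
  assumes "finite V" "set_mset M \<subseteq> V \<times> V" "\<And>v. \<bar>excess M v\<bar> \<le> 1"
  shows "card {v \<in> V. odd (excess M v)} = 2 * card {v \<in> V. excess M v = -1}"
proof -
  have "(\<Sum>v\<in>V. excess M v) = 0"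
    using assms(2)
  proof (induction M)
    case (add p M)
    then show ?case
      using \<open>finite V\<close> by (auto simp: sum.distrib sum_subtractf of_bool_def sum.delta)
  qed simp
  moreover have "excess M v = of_bool (excess M v = 1) - of_bool (excess M v = -1)" for v
    using assms(3)[of v] by auto
  then have "(\<Sum>v\<in>V. excess M v) =
      (\<Sum>v\<in>V. of_bool (excess M v = 1)) - (\<Sum>v\<in>V. of_bool (excess M v = -1))"
    by (metis (no_types, lifting) sum.cong sum_subtractf)
  ultimately have "card {v \<in> V. excess M v = 1} = card {v \<in> V. excess M v = -1}"
    using \<open>finite V\<close> by (simp add: sum_of_bool_eq Int_def)
  moreover have "odd (excess M v) \<longleftrightarrow> excess M v = 1 \<or> excess M v = -1" for v
    using assms(3)[of v] by presburger
  then have "{v \<in> V. odd (excess M v)} = {v \<in> V. excess M v = 1} \<union> {v \<in> V. excess M v = -1}"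
    by auto
  then have "card {v \<in> V. odd (excess M v)} =
      card {v \<in> V. excess M v = 1} + card {v \<in> V. excess M v = -1}"
    using \<open>finite V\<close> by (simp only:) (rule card_Un_disjoint; auto)
  ultimately show ?thesis by simp
qed

text \<open>The bound over the naturals. The proof shows that \<open>v_odd G\<close> is even, so
  \<open>div\<close> is exact here.\<close>

lemma p2_le:
  fixes G :: "'a ugraph"
  assumes "simple_graph G" "max_degree G \<le> 2 * k"
  shows "p2 G \<le> max (2 * k) (v_odd G div 2)"
proof -
  define V where "V = vertices G"
  define E where "E = edges G"
  have fin: "finite V" and E: "\<And>e. e \<in> E \<Longrightarrow> e \<subseteq> V \<and> card e = 2"
    using assms(1) by (auto simp: V_def E_def simple_graph_def)
  have "finite E"
    using finite_edges[OF assms(1)] by (simp add: E_def)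
  obtain M where M: "image_mset (\<lambda>p. {fst p, snd p}) M = mset_set E"
    and excess: "\<And>v. \<bar>excess M v\<bar> \<le> 1"
    using balanced_orientation[OF assms(1)] E_def by blast
  have "{fst p, snd p} \<in> E" if "p \<in># M" for p
    using that arg_cong[OF M, of set_mset] \<open>finite E\<close> by auto
  then have MV: "set_mset M \<subseteq> V \<times> V" and loopless: "\<forall>p\<in>#M. fst p \<noteq> snd p"
    using E by fastforce+
  have size_E: "size {#p \<in># M. P {fst p, snd p}#} = card {e \<in> E. P e}" for P
  proof -
    have "size {#p \<in># M. P {fst p, snd p}#} = size {#e \<in># mset_set E. P e#}"
      unfolding M[symmetric] by (simp add: filter_mset_image_mset)
    then show ?thesis
      using \<open>finite E\<close> by simp
  qed
  have degree: "vertex_degree G v = count (image_mset fst M) v + count (image_mset snd M) v" for v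
    using size_E[of "\<lambda>e. v \<in> e"] size_filter_incident[OF loopless, of v]
    by (simp add: vertex_degree_def E_def)
  have degree_le: "vertex_degree G v \<le> 2 * k" for v
  proof (cases "v \<in> V")
    case True
    then have "vertex_degree G v \<le> max_degree G"
      using fin unfolding max_degree_def V_def by (intro Max_ge) auto
    then show ?thesis
      using assms(2) by simp
  next
    case False
    then have "{e \<in> edges G. v \<in> e} = {}"
      using E by (auto simp: E_def)
    then show ?thesis
      by (simp only: vertex_degree_def card.empty zero_le)
  qed
  \<comment> \<open>Out- and indegree sum to at most \<open>2 * k\<close> and differ by at most one,
    so neither exceeds \<open>k\<close>.\<close>
  have le_k: "count (image_mset fst M) v \<le> k" "count (image_mset snd M) v \<le> k" for v
    using degree_le[of v] excess[of v] unfolding degree excess_eq_count by linarith+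
  have "odd (excess M v) \<longleftrightarrow> odd (vertex_degree G v)" for v
    by (simp add: degree excess_eq_count)
  then have v_odd: "v_odd G = 2 * card {v \<in> V. excess M v = -1}"
    using card_unbalanced[OF fin MV excess] by (simp add: v_odd_def V_def)
  obtain F L m where F: "(\<Sum>i<k. F i) = M + L" "\<forall>p\<in>#L. fst p = snd p"
    and part: "\<forall>i<k. image_mset fst (F i) \<subseteq># mset_set V \<and>
      image_mset snd (F i) \<subseteq># mset_set V \<and> size (F i) + m i = card V"
    and m: "(\<Sum>i<k. m i) = card {v \<in> V. excess M v = -1}"
    "\<forall>i<k. \<forall>j<k. \<bar>int (m i) - int (m j)\<bar> \<le> 1"
    using balanced_partial_injections[OF fin MV excess le_k] by blast
  have "\<forall>i\<in>{..<k}. \<exists>Ls. length Ls \<le> max 2 (m i) \<and>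
      (\<forall>L\<in>set Ls. L \<noteq> [] \<and> distinct L \<and> set L \<subseteq> V) \<and> (\<forall>e. card e = 2 \<longrightarrow>
      even ((\<Sum>L\<leftarrow>Ls. edge_count e L) + size {#p \<in># F i. {fst p, snd p} = e#}))"
    using part partial_injection_cover[OF fin] by blast
  then obtain Ls where Ls: "\<forall>i\<in>{..<k}. length (Ls i) \<le> max 2 (m i) \<and>
      (\<forall>L\<in>set (Ls i). L \<noteq> [] \<and> distinct L \<and> set L \<subseteq> V) \<and> (\<forall>e. card e = 2 \<longrightarrow>
      even ((\<Sum>L\<leftarrow>Ls i. edge_count e L) + size {#p \<in># F i. {fst p, snd p} = e#}))"
    unfolding bchoice_iff by blast
  define Ps where "Ps = concat (map Ls [0..<k])"
  have Ps: "L \<noteq> [] \<and> distinct L \<and> set L \<subseteq> V" if "L \<in> set Ps" for L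
  proof -
    have "\<exists>i\<in>{..<k}. L \<in> set (Ls i)"
      using that by (auto simp: Ps_def)
    then show ?thesis
      using Ls by blast
  qed
  have sum_Ps: "(\<Sum>L\<leftarrow>concat (map Ls [0..<j]). f L) = (\<Sum>i<j. \<Sum>L\<leftarrow>Ls i. f L)"
    for j and f :: "'a list \<Rightarrow> nat"
    by (induction j) auto
  have "length Ps = (\<Sum>i<k. length (Ls i))"
    using sum_Ps[of "\<lambda>_. 1" k] by (simp add: Ps_def sum_list_triv)
  also have "\<dots> \<le> (\<Sum>i<k. max 2 (m i))"
    using Ls by (intro sum_mono) simp
  also have "\<dots> = max (2 * k) (v_odd G div 2)"
    using sum_max_balanced[OF m(2)] m(1) v_odd by simp
  finally have len: "length Ps \<le> max (2 * k) (v_odd G div 2)" .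
  have "odd (\<Sum>L\<leftarrow>Ps. edge_count e L) \<longleftrightarrow> e \<in> E" for e
  proof (cases "card e = 2")
    case True
    have "(\<Sum>L\<leftarrow>Ps. edge_count e L) = (\<Sum>i<k. \<Sum>L\<leftarrow>Ls i. edge_count e L)"
      unfolding Ps_def by (rule sum_Ps)
    moreover have "(\<Sum>i<k. size {#p \<in># F i. {fst p, snd p} = e#}) = card {e' \<in> E. e' = e}"
    proof -
      \<comment> \<open>The ends of a loop form a singleton, so the added loops do not affect the
        parity at \<open>e\<close>.\<close>
      have "{#p \<in># L. {fst p, snd p} = e#} = {#}"
        using F(2) True by auto
      moreover have "(\<Sum>i<j. size {#p \<in># F i. {fst p, snd p} = e#}) =
          size {#p \<in># (\<Sum>i<j. F i). {fst p, snd p} = e#}" for j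
        by (induction j) auto
      ultimately show ?thesis
        using size_E[of "\<lambda>e'. e' = e"] by (simp add: F(1))
    qed
    moreover have "even (\<Sum>i<k. (\<Sum>L\<leftarrow>Ls i. edge_count e L) + size {#p \<in># F i. {fst p, snd p} = e#})"
      using Ls True by (intro dvd_sum) blast
    ultimately have "odd (\<Sum>L\<leftarrow>Ps. edge_count e L) \<longleftrightarrow> odd (card {e' \<in> E. e' = e})"
      by (simp add: sum.distrib)
    also have "{e' \<in> E. e' = e} = (if e \<in> E then {e} else {})"
      by auto
    finally show ?thesis by simp
  next
    \<comment> \<open>\<open>edge_sym_diff\<close> ranges over all sets, so those without exactly
      two elements have to be excluded as well.\<close>
    case False
    then have "\<forall>L\<in>set Ps. edge_count e L = 0"
      using Ps edge_count_card by blast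
    then have "map (edge_count e) Ps = map (\<lambda>_. 0) Ps"
      by simp
    then have "even (\<Sum>L\<leftarrow>Ps. edge_count e L)"
      by (simp only: sum_list_0 even_zero)
    moreover have "e \<notin> E"
      using False E by blast
    ultimately show ?thesis by blast
  qed
  then have "{e. odd (\<Sum>L\<leftarrow>Ps. edge_count e L)} = E"
    by blast
  then obtain C where "card C \<le> length Ps" "path_odd_cover G C"
    using path_list_to_set[OF Ps] unfolding path_odd_cover_def V_def E_def by metis
  then have "p2 G \<le> length Ps"
    unfolding p2_def by (intro order_trans[OF Least_le, of _ "card C"]) auto
  with len show ?thesis by simp
qed

theorem theorem1p3:
  fixes G :: "'a ugraph"
  assumes "simple_graph G"
  shows "real (p2 G) \<le>
    max (real (v_odd G) / 2) (2 * real_of_int \<lceil>real (max_degree G) / 2\<rceil>)"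
proof -
  define k where "k = nat \<lceil>real (max_degree G) / 2\<rceil>"
  have k: "real k = real_of_int \<lceil>real (max_degree G) / 2\<rceil>"
    by (simp add: k_def)
  then have "real (max_degree G) / 2 \<le> real k"
    by simp
  then have "max_degree G \<le> 2 * k"
    by linarith
  then have "p2 G \<le> max (2 * k) (v_odd G div 2)"
    by (rule p2_le[OF assms])
  then have "real (p2 G) \<le> max (2 * real k) (real (v_odd G div 2))"
    by (simp add: max_def split: if_splits)
  also have "\<dots> \<le> max (2 * real k) (real (v_odd G) / 2)"
    by (intro max.mono) auto
  finally show ?thesis
    by (simp add: k max.commute)
qed

end
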